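(* Let $\xi$ be a random variable and $f(x)=\mathbb{E}_\xi[f(x,\xi)]$, where for every outcome of $\xi$ the function $f(\cdot,\xi):\mathbb{R}^d\to\mathbb{R}$ is $\rho$-weakly convex ($\rho\ge0$). Let $\eta>0$ and suppose that for almost every $\xi$, $f_\eta(\cdot,\xi)$ is a $(\bar\rho,\mathcal{R}_{\xi,\eta},\mathcal{L}_{\xi,\eta})$-smooth approximation of $f(\cdot,\xi)$ on $\mathbb{R}^d$, where $\mathcal{R}_{\xi,\eta}:\mathbb{R}^d\to(0,\infty)$ and $\mathcal{L}_{\xi,\eta}:\mathbb{R}^d\times\mathbb{R}^d\to(0,\infty)$ are integrable in $\xi$ (for each fixed argument). Further assume that for every fixed $x\in\mathbb{R}^d$: 1) $\mathbb{E}_\xi[|f_\eta(x,\xi)|]<+\infty$; 2) there exists a nonnegative random variable $C(\xi)$ with $\mathbb{E}_\xi[C(\xi)]<+\infty$ such that, almost surely, $f_\eta(\cdot,\xi)$ is Lipschitz continuous with modulus $C(\xi)$ in a neighborhood of $x$ (the neighborhood not depending on $\xi$). Let $f_\eta(x):=\mathbb{E}_\xi[f_\eta(x,\xi)]$, $\mathcal{R}_\eta(x):=\mathbb{E}_\xi[\mathcal{R}_{\xi,\eta}(x)]$, $\mathcal{L}_\eta(x,y):=\mathbb{E}_\xi[\mathcal{L}_{\xi,\eta}(x,y)]$. Then $f_\eta$ is differentiable with $\nabla f_\eta(x)=\mathbb{E}_\xi[\nabla f_\eta(x,\xi)]$, and $f_\eta$ is a $(\bar\rho,\mathcal{R}_\eta,\mathcal{L}_\eta)$-smooth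 approximation of $f$.
   Context: $\|\cdot\|$ is the Euclidean norm; gradients are with respect to $x$. A function $g$ is $\rho$-weakly convex if $g+\frac\rho2\|\cdot\|^2$ is convex. The functions $f(x,\cdot)$, $f_\eta(x,\cdot)$ are measurable for each $x$. A continuously differentiable $g_\eta:\mathbb{R}^d\to\mathbb{R}$ is a $(\bar\rho,\mathcal{R}_\eta,\mathcal{L}_\eta)$-smooth approximation of a weakly convex $g$ (with constant $\bar\rho>0$ not depending on $\eta$, $\mathcal{R}_\eta:\mathbb{R}^d\to[0,\infty)$, $\mathcal{L}_\eta:\mathbb{R}^d\times\mathbb{R}^d\to[0,\infty)$ symmetric) if: $g_\eta$ is $\bar\rho$-weakly convex; $g_\eta(x)\le g(x)\le g_\eta(x)+\mathcal{R}_\eta(x)$ for all $x$; and $\|\nabla g_\eta(x)-\nabla g_\eta(y)\|\le\mathcal{L}_\eta(x,y)\|x-y\|$ for all $x,y$. *)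

theory Defs
  imports "HOL-Probability.Probability"
begin

definition weakly_convex :: "real \<Rightarrow> ('a::real_inner \<Rightarrow> real) \<Rightarrow> bool" where
  "weakly_convex \<rho> g \<longleftrightarrow> convex_on UNIV (\<lambda>x. g x + \<rho> / 2 * (norm x)\<^sup>2)"

text \<open>Unspecified where \<open>g\<close> is not Frechet differentiable.\<close>

definition grad :: "('a::real_inner \<Rightarrow> real) \<Rightarrow> 'a \<Rightarrow> 'a" where
  "grad g x = (THE D. GDERIV g x :> D)"

definition continuously_differentiable :: "('a::real_inner \<Rightarrow> real) \<Rightarrow> bool" where
  "continuously_differentiable g \<longleftrightarrow>
     (\<forall>x. g differentiable (at x)) \<and> continuous_on UNIV (grad g)"

text \<open>\<open>smooth_approx \<rho>' R L h g\<close>: the function \<open>h\<close> is a \<open>(\<rho>', R, L)\<close>-smooth approximation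
  of the weakly convex function \<open>g\<close>, whose own modulus of weak convexity is not a parameter.\<close>

definition smooth_approx ::
  "real \<Rightarrow> ('a::euclidean_space \<Rightarrow> real) \<Rightarrow> ('a \<Rightarrow> 'a \<Rightarrow> real) \<Rightarrow>
    ('a \<Rightarrow> real) \<Rightarrow> ('a \<Rightarrow> real) \<Rightarrow> bool" where
  "smooth_approx \<rho>' R L h g \<longleftrightarrow>
     (\<exists>\<rho>\<ge>0. weakly_convex \<rho> g) \<and>
     \<rho>' > 0 \<and>
     (\<forall>x. R x \<ge> 0) \<and>
     (\<forall>x y. L x y \<ge> 0) \<and>
     (\<forall>x y. L x y = L y x) \<and>
     continuously_differentiable h \<and>
     weakly_convex \<rho>' h \<and>
     (\<forall>x. h x \<le> g x \<and> g x \<le> h x + R x) \<and>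
     (\<forall>x y. norm (grad h x - grad h y) \<le> L x y * norm (x - y))"

text \<open>In the theorem, the gradient of the sampled function exists only almost surely. When the
  probability space is not complete, the values of \<open>grad\<close> on the exceptional null set can destroy
  measurability, which would make the Bochner integral zero by convention. Its expectation is
  therefore taken over the completion of the measure, where null sets do not matter; for
  functions measurable with respect to the original measure the two integrals agree.\<close>

end

theory Submission
  imports Defs
begin

text \<open>Near \<open>x\<close> the Lipschitz modulus \<open>C\<close> dominates both the gradients and the difference quotients
  of the sampled functions, so dominated convergence differentiates under the expectation and makes
  the resulting gradient continuous; no local bound on \<open>L\<close> is available for the latter.
  The remaining properties are pointwise inequalities that pass to expectations. All
  integrals involving gradients live on the completion, where a function that agrees almost
  everywhere with a limit of measurable functions is measurable.\<close>

section \<open>Gradients, directional derivatives and Lipschitz bounds\<close>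

lemma gderiv_unique:
  assumes "GDERIV g x :> D" "GDERIV g x :> E"
  shows "D = E"
proof -
  have "(\<lambda>h. h \<bullet> D) = (\<lambda>h. h \<bullet> E)"
    using assms has_derivative_unique unfolding gderiv_def by blast
  then show ?thesis
    by (metis inner_commute vector_eq_rdot)
qed

lemma grad_eqI: "GDERIV g x :> D \<Longrightarrow> grad g x = D"
  unfolding grad_def by (blast intro: gderiv_unique)

lemma gderiv_differentiable: "GDERIV g x :> D \<Longrightarrow> g differentiable (at x)"
  unfolding gderiv_def by (rule differentiableI)

text \<open>Riesz representation in finite dimension: the linear functional \<open>g'\<close> is the
  inner product with the vector whose coordinates are its values on \<open>Basis\<close>. Hence the
  description in \<open>grad\<close> denotes.\<close>

lemma gderiv_grad:
  fixes g :: "'a::euclidean_space \<Rightarrow> real"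
  assumes "g differentiable (at x)"
  shows "GDERIV g x :> grad g x"
proof -
  from assms obtain g' where g': "(g has_derivative g') (at x)"
    unfolding differentiable_def by blast
  then interpret bounded_linear g'
    by (rule has_derivative_bounded_linear)
  define D where "D = (\<Sum>b\<in>Basis. g' b *\<^sub>R b)"
  have "g' = (\<lambda>h. h \<bullet> D)"
  proof
    fix h
    have "g' h = g' (\<Sum>b\<in>Basis. (h \<bullet> b) *\<^sub>R b)"
      by (simp add: euclidean_representation)
    also have "\<dots> = h \<bullet> D"
      by (simp add: sum scaleR D_def inner_sum_right mult.commute)
    finally show "g' h = h \<bullet> D" .
  qed
  with g' have "GDERIV g x :> D"
    by (simp add: gderiv_def)
  then show ?thesis
    by (simp add: grad_eqI)
qed

text \<open>The chain rule along a line. These scalar limits serve twice: they bound a gradient by a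
  Lipschitz modulus, and they exhibit its coordinates as limits of measurable functions.\<close>

lemma gderiv_line:
  assumes "GDERIV g x :> D"
  shows "((\<lambda>t. (g (x + t *\<^sub>R v) - g x) / t) \<longlongrightarrow> v \<bullet> D) (at 0)"
proof -
  have "(g has_derivative (\<lambda>h. h \<bullet> D)) (at (x + 0 *\<^sub>R v))"
    using assms by (simp add: gderiv_def)
  then have "((\<lambda>t. g (x + t *\<^sub>R v)) has_derivative (\<lambda>t. (t *\<^sub>R v) \<bullet> D)) (at 0)"
    by (rule has_derivative_compose[rotated]) (auto intro!: derivative_eq_intros)
  then have "((\<lambda>t. g (x + t *\<^sub>R v)) has_field_derivative (v \<bullet> D)) (at 0)"
    by (simp add: has_field_derivative_def mult_commute_abs)
  then show ?thesis
    by (simp add: DERIV_def)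
qed

text \<open>In the direction \<open>D\<close> itself the difference quotients are at most
  \<open>C * norm D\<close> and tend to \<open>D \<bullet> D\<close>, the square of
  \<open>norm D\<close>; one factor cancels. For \<open>D = 0\<close> only \<open>C \<ge> 0\<close>
  is left, which is part of being Lipschitz.\<close>

lemma gderiv_lipschitz_bound:
  assumes "GDERIV g x :> D" "C-lipschitz_on U g" "open U" "x \<in> U"
  shows "norm D \<le> C"
proof (cases "D = 0")
  case True
  then show ?thesis
    using assms(2) by (simp add: lipschitz_on_def)
next
  case False
  have "\<forall>\<^sub>F t in at 0. x + t *\<^sub>R D \<in> U"
  proof (rule topological_tendstoD)
    show "((\<lambda>t. x + t *\<^sub>R D) \<longlongrightarrow> x) (at (0::real))"
      by (auto intro!: tendsto_eq_intros)
  qed (use assms in auto)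
  moreover have "\<forall>\<^sub>F t in at (0::real). t \<noteq> 0"
    by (auto simp: eventually_at_filter)
  ultimately have "\<forall>\<^sub>F t in at 0. (g (x + t *\<^sub>R D) - g x) / t \<le> C * norm D"
  proof eventually_elim
    case (elim t)
    then have "\<bar>g (x + t *\<^sub>R D) - g x\<bar> \<le> C * (\<bar>t\<bar> * norm D)"
      using lipschitz_onD[OF assms(2), of "x + t *\<^sub>R D" x] assms(4)
      by (simp add: dist_norm)
    then have "\<bar>(g (x + t *\<^sub>R D) - g x) / t\<bar> \<le> C * norm D"
      using elim by (simp add: abs_divide pos_divide_le_eq mult_ac)
    then show ?case
      by linarith
  qed
  then have "D \<bullet> D \<le> C * norm D"
    using tendsto_upperbound[OF gderiv_line[OF assms(1), of D]] by simp
  then show ?thesis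
    using False by (simp add: dot_square_norm power2_eq_square)
qed

section \<open>Measurability up to null sets on a complete measure space\<close>

lemma (in complete_measure) measurable_AE_eq:
  assumes g: "g \<in> measurable M N" and ae: "AE \<omega> in M. g \<omega> = h \<omega>"
    and h: "h \<in> space M \<rightarrow> space N"
  shows "h \<in> measurable M N"
proof (rule measurableI)
  fix A assume "A \<in> sets N"
  then have meas: "g -` A \<inter> space M \<in> sets M"
    by (rule measurable_sets[OF g])
  \<comment> \<open>The two preimages differ only inside a null set, and completeness makes every
    such modification of a measurable set measurable.\<close>
  have *: "AE \<omega> in M. \<omega> \<in> g -` A \<inter> space M \<longleftrightarrow> \<omega> \<in> h -` A \<inter> space M"
    using ae by eventually_elim auto
  show "h -` A \<inter> space M \<in> sets M"
    by (rule in_sets_AE[OF * meas]) auto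
qed (use h in auto)

text \<open>The total function \<open>lim\<close> is measurable whatever value it takes where the
  sequence diverges, and it differs from \<open>h\<close> only on a null set.\<close>

lemma (in complete_measure) borel_measurable_AE_LIMSEQ:
  fixes s :: "nat \<Rightarrow> 'a \<Rightarrow> 'b::{banach, second_countable_topology}"
  assumes [measurable]: "\<And>n. s n \<in> borel_measurable M"
    and lim: "AE \<omega> in M. (\<lambda>n. s n \<omega>) \<longlonglongrightarrow> h \<omega>"
  shows "h \<in> borel_measurable M"
proof (rule measurable_AE_eq)
  show "(\<lambda>\<omega>. lim (\<lambda>n. s n \<omega>)) \<in> borel_measurable M"
    by measurable
  show "AE \<omega> in M. lim (\<lambda>n. s n \<omega>) = h \<omega>"
    using lim by eventually_elim (rule limI)
qed simp

section \<open>Dominated convergence and differentiation under the integral\<close>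

lemma integral_dominated_convergence_at:
  fixes s :: "'b::metric_space \<Rightarrow> 'a \<Rightarrow> 'c::{banach, second_countable_topology}"
  assumes meas: "h \<in> borel_measurable M" "\<And>y. s y \<in> borel_measurable M"
    and w: "integrable M w"
    and lim: "AE \<omega> in M. ((\<lambda>y. s y \<omega>) \<longlongrightarrow> h \<omega>) (at x)"
    and bound: "\<forall>\<^sub>F y in at x. AE \<omega> in M. norm (s y \<omega>) \<le> w \<omega>"
  shows "((\<lambda>y. \<integral>\<omega>. s y \<omega> \<partial>M) \<longlongrightarrow> (\<integral>\<omega>. h \<omega> \<partial>M)) (at x)"
  \<comment> \<open>The null set in \<open>bound\<close> may vary with \<open>y\<close>. Along a
    sequence only countably many of them occur, so the sequential theorem applies.\<close>
  unfolding tendsto_at_iff_sequentially comp_def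
proof safe
  fix X assume X: "\<forall>n. X n \<in> UNIV - {x}" "X \<longlonglongrightarrow> x"
  then have at: "filterlim X (at x) sequentially"
    by (auto simp: filterlim_at)
  then obtain n0 where n0: "\<And>n. n \<ge> n0 \<Longrightarrow> AE \<omega> in M. norm (s (X n) \<omega>) \<le> w \<omega>"
    using bound unfolding filterlim_iff eventually_sequentially by blast
  show "(\<lambda>n. \<integral>\<omega>. s (X n) \<omega> \<partial>M) \<longlonglongrightarrow> (\<integral>\<omega>. h \<omega> \<partial>M)"
  \<comment> \<open>The domination is known only from index \<open>n0\<close> on, so the sequence is
    shifted by \<open>n0\<close>.\<close>
  proof (rule LIMSEQ_offset[where k = n0], rule integral_dominated_convergence[OF meas w])
    show "AE \<omega> in M. (\<lambda>n. s (X (n + n0)) \<omega>) \<longlonglongrightarrow> h \<omega>"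
      using lim by eventually_elim
        (rule LIMSEQ_ignore_initial_segment, rule filterlim_compose[OF _ at])
  qed (simp add: n0)
qed

text \<open>The normalized first-order remainders tend to 0 almost everywhere and are dominated near
  \<open>x\<close> by a multiple of \<open>C\<close>, so their integrals tend to 0 as well; by
  linearity these integrals are the remainders of the integrated function. Measurability of
  \<open>G\<close> is not assumed but derived from completeness.\<close>

lemma (in complete_measure) integral_gderiv:
  fixes h :: "'b::euclidean_space \<Rightarrow> 'a \<Rightarrow> real"
  assumes int: "\<And>y. integrable M (h y)"
    and diff: "AE \<omega> in M. GDERIV (\<lambda>y. h y \<omega>) x :> G \<omega>"
    and C: "integrable M C"
    and U: "open U" "x \<in> U"
    and lip: "AE \<omega> in M. (C \<omega>)-lipschitz_on U (\<lambda>y. h y \<omega>)"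
  shows "integrable M G" "GDERIV (\<lambda>y. \<integral>\<omega>. h y \<omega> \<partial>M) x :> (\<integral>\<omega>. G \<omega> \<partial>M)"
proof -
  have [measurable]: "h y \<in> borel_measurable M" for y
    using int by (rule borel_measurable_integrable)
  have "(\<lambda>\<omega>. G \<omega> \<bullet> b) \<in> borel_measurable M" for b
  proof (rule borel_measurable_AE_LIMSEQ)
    \<comment> \<open>The step \<open>1 / real (Suc n)\<close> is never 0, so it converges in the
      punctured filter \<open>at 0\<close> required by \<open>gderiv_line\<close>.\<close>
    show "AE \<omega> in M. (\<lambda>n. (h (x + (1 / real (Suc n)) *\<^sub>R b) \<omega> - h x \<omega>) / (1 / real (Suc n)))
        \<longlonglongrightarrow> G \<omega> \<bullet> b"
      using diff
    proof eventually_elim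
      case (elim \<omega>)
      have "filterlim (\<lambda>n. 1 / real (Suc n)) (at 0) sequentially"
        using LIMSEQ_inverse_real_of_nat by (simp add: filterlim_at inverse_eq_divide)
      from filterlim_compose[OF gderiv_line[OF elim, of b] this] show ?case
        by (simp add: inner_commute)
    qed
  qed measurable
  then have G[measurable]: "G \<in> borel_measurable M"
    using borel_measurable_euclidean_space[of G M] by blast
  have G_le: "AE \<omega> in M. norm (G \<omega>) \<le> C \<omega>"
    using diff lip by eventually_elim (rule gderiv_lipschitz_bound[OF _ _ U])
  show int_G: "integrable M G"
    by (rule Bochner_Integration.integrable_bound[OF C G]) (use G_le in eventually_elim, auto)
  define q where "q y \<omega> = (h y \<omega> - h x \<omega> - (y - x) \<bullet> G \<omega>) /\<^sub>R norm (y - x)" for y \<omega>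
  have "((\<lambda>y. \<integral>\<omega>. q y \<omega> \<partial>M) \<longlongrightarrow> (\<integral>\<omega>. 0 \<partial>M)) (at x)"
  \<comment> \<open>One \<open>C\<close> bounds the increment of \<open>h\<close> through the
    Lipschitz property; the other bounds the linear term through Cauchy-Schwarz and
    \<open>G_le\<close>.\<close>
  proof (rule integral_dominated_convergence_at[where w = "\<lambda>\<omega>. 2 * C \<omega>"])
    show "AE \<omega> in M. ((\<lambda>y. q y \<omega>) \<longlongrightarrow> 0) (at x)"
      using diff by eventually_elim (simp add: q_def gderiv_def has_derivative_at_within)
    have "\<forall>\<^sub>F y in at x. y \<in> U \<and> y \<noteq> x"
      using U by (auto simp: eventually_at_topological)
    then show "\<forall>\<^sub>F y in at x. AE \<omega> in M. norm (q y \<omega>) \<le> 2 * C \<omega>"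
    proof eventually_elim
      case y: (elim y)
      show ?case
        using lip G_le
      proof eventually_elim
        case (elim \<omega>)
        have "\<bar>h y \<omega> - h x \<omega>\<bar> \<le> C \<omega> * norm (y - x)"
          using lipschitz_onD[OF elim(1), of y x] y U by (simp add: dist_norm)
        moreover have "\<bar>(y - x) \<bullet> G \<omega>\<bar> \<le> C \<omega> * norm (y - x)"
          using Cauchy_Schwarz_ineq2[of "y - x" "G \<omega>"]
            mult_left_mono[OF elim(2), of "norm (y - x)"] by (simp add: mult.commute)
        ultimately have "\<bar>h y \<omega> - h x \<omega> - (y - x) \<bullet> G \<omega>\<bar> \<le> 2 * C \<omega> * norm (y - x)"
          by linarith
        then show ?case
          using y by (simp add: q_def field_simps)
      qed
    qed
    show "q y \<in> borel_measurable M" for y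
      unfolding q_def[abs_def] by measurable
  qed (use C in auto)
  moreover have "(\<integral>\<omega>. q y \<omega> \<partial>M) =
      ((\<integral>\<omega>. h y \<omega> \<partial>M) - (\<integral>\<omega>. h x \<omega> \<partial>M) - (y - x) \<bullet> (\<integral>\<omega>. G \<omega> \<partial>M)) /\<^sub>R norm (y - x)" for y
    using int int_G by (simp add: q_def)
  ultimately show "GDERIV (\<lambda>y. \<integral>\<omega>. h y \<omega> \<partial>M) x :> (\<integral>\<omega>. G \<omega> \<partial>M)"
    unfolding gderiv_def by (intro has_derivativeI bounded_linear_inner_left) simp
qed

text \<open>The quadratic term is deterministic and the total mass is one, so it passes through the
  expectation unchanged; what remains is the expectation of the convexity inequality.\<close>

lemma (in prob_space) weakly_convex_expectation:
  assumes int: "\<And>x. integrable M (h x)"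
    and wc: "AE \<omega> in M. weakly_convex \<rho> (\<lambda>x. h x \<omega>)"
  shows "weakly_convex \<rho> (\<lambda>x. expectation (h x))"
  unfolding weakly_convex_def
proof (rule convex_onI)
  fix t :: real and x y
  assume t: "0 < t" "t < 1"
  define k where "k x \<omega> = h x \<omega> + \<rho> / 2 * (norm x)\<^sup>2" for x \<omega>
  have int_k: "integrable M (k x)" for x
    unfolding k_def[abs_def] using int by simp
  have k: "expectation (k x) = expectation (h x) + \<rho> / 2 * (norm x)\<^sup>2" for x
    unfolding k_def using int by (simp add: prob_space)
  have "expectation (k ((1 - t) *\<^sub>R x + t *\<^sub>R y)) \<le>
      expectation (\<lambda>\<omega>. (1 - t) * k x \<omega> + t * k y \<omega>)"
  proof (rule integral_mono_AE)
    show "AE \<omega> in M. k ((1 - t) *\<^sub>R x + t *\<^sub>R y) \<omega> \<le> (1 - t) * k x \<omega> + t * k y \<omega>"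
      using wc
    proof eventually_elim
      case (elim \<omega>)
      then have "convex_on UNIV (\<lambda>x. k x \<omega>)"
        by (simp add: weakly_convex_def k_def)
      then show ?case
        using t convex_onD[of UNIV "\<lambda>x. k x \<omega>" t x y] by simp
    qed
  qed (auto intro!: int_k)
  also have "\<dots> = (1 - t) * expectation (k x) + t * expectation (k y)"
    using int_k by simp
  finally show "expectation (h ((1 - t) *\<^sub>R x + t *\<^sub>R y)) +
      \<rho> / 2 * (norm ((1 - t) *\<^sub>R x + t *\<^sub>R y))\<^sup>2 \<le>
      (1 - t) * (expectation (h x) + \<rho> / 2 * (norm x)\<^sup>2) +
      t * (expectation (h y) + \<rho> / 2 * (norm y)\<^sup>2)"
    by (simp add: k)
qed simp

section \<open>Gradient, regularity and error bounds of the expected functions\<close>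

theorem theorem4p3:
  fixes M :: "'w measure" and N :: "'s measure" and \<xi> :: "'w \<Rightarrow> 's"
    and f :: "'a::euclidean_space \<Rightarrow> 's \<Rightarrow> real"
    and f_s :: "real \<Rightarrow> 'a \<Rightarrow> 's \<Rightarrow> real"
    and R :: "'s \<Rightarrow> real \<Rightarrow> 'a \<Rightarrow> real"
    and L :: "'s \<Rightarrow> real \<Rightarrow> 'a \<Rightarrow> 'a \<Rightarrow> real"
    and \<rho> \<rho>' \<eta> :: real
  assumes "prob_space M"
    and "\<xi> \<in> measurable M N"
    and "\<rho> \<ge> 0"
    and "\<eta> > 0"
    and "\<And>x. f x \<in> borel_measurable N"
    and "\<And>x. f_s \<eta> x \<in> borel_measurable N"
    and "\<And>\<omega>. \<omega> \<in> space M \<Longrightarrow> weakly_convex \<rho> (\<lambda>x. f x (\<xi> \<omega>))"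
    and "AE \<omega> in M.
           (\<forall>x. R (\<xi> \<omega>) \<eta> x > 0) \<and> (\<forall>x y. L (\<xi> \<omega>) \<eta> x y > 0) \<and>
           smooth_approx \<rho>' (R (\<xi> \<omega>) \<eta>) (L (\<xi> \<omega>) \<eta>)
             (\<lambda>x. f_s \<eta> x (\<xi> \<omega>)) (\<lambda>x. f x (\<xi> \<omega>))"
    and "\<And>x. integrable M (\<lambda>\<omega>. R (\<xi> \<omega>) \<eta> x)"
    and "\<And>x y. integrable M (\<lambda>\<omega>. L (\<xi> \<omega>) \<eta> x y)"
    and "\<And>x. integrable M (\<lambda>\<omega>. f_s \<eta> x (\<xi> \<omega>))"
    and "\<And>x. \<exists>C \<in> borel_measurable N. (\<forall>z \<in> space N. C z \<ge> 0) \<and>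
           integrable M (\<lambda>\<omega>. C (\<xi> \<omega>)) \<and>
           (\<exists>U. open U \<and> x \<in> U \<and>
             (AE \<omega> in M. (C (\<xi> \<omega>))-lipschitz_on U (\<lambda>y. f_s \<eta> y (\<xi> \<omega>))))"
  defines "F \<equiv> \<lambda>x. \<integral>\<omega>. f x (\<xi> \<omega>) \<partial>M"
    and "F_s \<equiv> \<lambda>x. \<integral>\<omega>. f_s \<eta> x (\<xi> \<omega>) \<partial>M"
    and "R_E \<equiv> \<lambda>x. \<integral>\<omega>. R (\<xi> \<omega>) \<eta> x \<partial>M"
    and "L_E \<equiv> \<lambda>x y. \<integral>\<omega>. L (\<xi> \<omega>) \<eta> x y \<partial>M"
  shows "(\<forall>x. F_s differentiable (at x)) \<and>
    (\<forall>x. has_bochner_integral (completion M)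
           (\<lambda>\<omega>. grad (\<lambda>y. f_s \<eta> y (\<xi> \<omega>)) x) (grad F_s x)) \<and>
    smooth_approx \<rho>' R_E L_E F_s F"
proof -
  interpret prob_space M by fact
  note [measurable] = assms(2,5,6)
  define M' where "M' = completion M"
  interpret complete_measure M'
    unfolding M'_def by (rule completion.complete_measure_axioms)
  define h where "h x \<omega> = f_s \<eta> x (\<xi> \<omega>)" for x \<omega>
  define G where "G x \<omega> = grad (\<lambda>y. h y \<omega>) x" for x \<omega>
  have approx: "AE \<omega> in M. smooth_approx \<rho>' (R (\<xi> \<omega>) \<eta>) (L (\<xi> \<omega>) \<eta>)
      (\<lambda>x. h x \<omega>) (\<lambda>x. f x (\<xi> \<omega>))"
    using assms(8) by (auto simp: h_def)
  have int_h: "integrable M (h x)" for x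
    unfolding h_def[abs_def] by (rule assms(11))
  have h_meas: "h x \<in> borel_measurable M" for x
    using int_h by (rule borel_measurable_integrable)
  have int_h': "integrable M' (h x)" for x
    unfolding M'_def using int_h h_meas by (simp add: integrable_completion)
  \<comment> \<open>\<open>h x\<close> is measurable for \<open>M\<close>, so both measures give the
    same integral. The form over \<open>M'\<close> is for differentiation, the form over
    \<open>M\<close> for the inequalities between function values.\<close>
  have F_s_eq: "F_s x = (\<integral>\<omega>. h x \<omega> \<partial>M')" for x
    unfolding M'_def integral_completion[OF h_meas] by (simp add: F_s_def h_def[abs_def])
  have F_s_eq': "F_s x = expectation (h x)" for x
    by (simp add: F_s_def h_def[abs_def])
  have approx': "AE \<omega> in M'. smooth_approx \<rho>' (R (\<xi> \<omega>) \<eta>) (L (\<xi> \<omega>) \<eta>)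
      (\<lambda>x. h x \<omega>) (\<lambda>x. f x (\<xi> \<omega>))"
    unfolding M'_def by (rule AE_completion[OF approx])
  have GDERIV_h: "AE \<omega> in M'. GDERIV (\<lambda>y. h y \<omega>) x :> G x \<omega>" for x
    using approx' unfolding G_def
    by eventually_elim (auto simp: smooth_approx_def continuously_differentiable_def
        intro: gderiv_grad)
  have lip: "\<exists>C U. integrable M' C \<and> open U \<and> x \<in> U \<and>
      (AE \<omega> in M'. (C \<omega>)-lipschitz_on U (\<lambda>y. h y \<omega>))" for x
  proof -
    obtain C U where C: "C \<in> borel_measurable N" "integrable M (\<lambda>\<omega>. C (\<xi> \<omega>))"
      and U: "open U" "x \<in> U" "AE \<omega> in M. (C (\<xi> \<omega>))-lipschitz_on U (\<lambda>y. h y \<omega>)"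
      using assms(12)[of x] unfolding h_def by blast
    have "integrable M' (\<lambda>\<omega>. C (\<xi> \<omega>))"
      unfolding M'_def using C by (simp add: integrable_completion)
    then show ?thesis
      using U AE_completion[OF U(3)] unfolding M'_def by blast
  qed
  have G: "integrable M' (G x)" and GDERIV_F: "GDERIV F_s x :> (\<integral>\<omega>. G x \<omega> \<partial>M')" for x
  proof -
    obtain C U where *: "integrable M' C" "open U" "x \<in> U"
        "AE \<omega> in M'. (C \<omega>)-lipschitz_on U (\<lambda>y. h y \<omega>)"
      using lip by blast
    show "integrable M' (G x)" "GDERIV F_s x :> (\<integral>\<omega>. G x \<omega> \<partial>M')"
      unfolding F_s_eq[abs_def] using integral_gderiv[OF int_h' GDERIV_h *] by auto
  qed
  have grad_F: "grad F_s x = (\<integral>\<omega>. G x \<omega> \<partial>M')" for x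
    by (rule grad_eqI[OF GDERIV_F])
  have "isCont (grad F_s) x" for x
  proof -
    obtain C U where *: "integrable M' C" "open U" "x \<in> U"
        "AE \<omega> in M'. (C \<omega>)-lipschitz_on U (\<lambda>y. h y \<omega>)"
      using lip by blast
    \<comment> \<open>For almost every \<omega> the sampled gradient is continuous by the definition
      of a smooth approximation; only a dominating function for \<open>y\<close> near
      \<open>x\<close> has to be supplied.\<close>
    have "((\<lambda>y. \<integral>\<omega>. G y \<omega> \<partial>M') \<longlongrightarrow> (\<integral>\<omega>. G x \<omega> \<partial>M')) (at x)"
    proof (rule integral_dominated_convergence_at[OF _ _ *(1)])
      show "AE \<omega> in M'. ((\<lambda>y. G y \<omega>) \<longlongrightarrow> G x \<omega>) (at x)"
        using approx' by eventually_elim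
          (auto simp: smooth_approx_def continuously_differentiable_def G_def
            continuous_on_eq_continuous_at isCont_def)
      have "\<forall>\<^sub>F y in at x. y \<in> U"
        using * by (auto simp: eventually_at_topological)
      \<comment> \<open>\<open>U\<close> is open and hence a neighborhood of each of its points, so
        the single modulus \<open>C\<close> chosen for \<open>x\<close> bounds the gradients at all
        \<open>y\<close> in \<open>U\<close>.\<close>
      then show "\<forall>\<^sub>F y in at x. AE \<omega> in M'. norm (G y \<omega>) \<le> C \<omega>"
      proof eventually_elim
        case y: (elim y)
        show ?case
          using GDERIV_h[of y] *(4)
          by eventually_elim (rule gderiv_lipschitz_bound[OF _ _ *(2) y])
      qed
    qed (auto intro: borel_measurable_integrable[OF G])
    then show ?thesis
      by (simp add: isCont_def grad_F[abs_def])
  qed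
  then have cont_diff: "continuously_differentiable F_s"
    unfolding continuously_differentiable_def
    using gderiv_differentiable[OF GDERIV_F] by (simp add: continuous_on_eq_continuous_at)
  have grad_lip: "norm (grad F_s x - grad F_s y) \<le> L_E x y * norm (x - y)" for x y
  proof -
    have int_L: "integrable M' (\<lambda>\<omega>. L (\<xi> \<omega>) \<eta> x y)"
      unfolding M'_def using assms(10)[of x y]
      by (simp add: integrable_completion borel_measurable_integrable)
    \<comment> \<open>The norm moves inside the integral, where the sampled bound holds almost
      everywhere. The factor \<open>norm (x - y)\<close> is constant, leaving the integral of
      \<open>L\<close>, which agrees over \<open>M'\<close> and \<open>M\<close>.\<close>
    have "norm (grad F_s x - grad F_s y) = norm (\<integral>\<omega>. G x \<omega> - G y \<omega> \<partial>M')"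
      using G by (simp add: grad_F)
    also have "\<dots> \<le> (\<integral>\<omega>. norm (G x \<omega> - G y \<omega>) \<partial>M')"
      by (rule integral_norm_bound)
    also have "\<dots> \<le> (\<integral>\<omega>. L (\<xi> \<omega>) \<eta> x y * norm (x - y) \<partial>M')"
    proof (rule integral_mono_AE)
      show "AE \<omega> in M'. norm (G x \<omega> - G y \<omega>) \<le> L (\<xi> \<omega>) \<eta> x y * norm (x - y)"
        using approx' by eventually_elim (auto simp: smooth_approx_def G_def)
    qed (use G int_L in auto)
    also have "\<dots> = L_E x y * norm (x - y)"
      using int_L assms(10)[of x y]
      by (simp add: M'_def L_E_def integral_completion borel_measurable_integrable)
    finally show ?thesis .
  qed
  have sandwich: "AE \<omega> in M. h x \<omega> \<le> f x (\<xi> \<omega>) \<and> f x (\<xi> \<omega>) \<le> h x \<omega> + R (\<xi> \<omega>) \<eta> x" for x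
    using approx by eventually_elim (auto simp: smooth_approx_def)
  \<comment> \<open>Integrability of \<open>f\<close> is not among the hypotheses. It follows from
    the sandwich, which places \<open>f\<close> between the integrable functions \<open>h\<close>
    and \<open>h + R\<close>.\<close>
  have int_f: "integrable M (\<lambda>\<omega>. f x (\<xi> \<omega>))" for x
  proof (rule Bochner_Integration.integrable_bound)
    show "integrable M (\<lambda>\<omega>. \<bar>h x \<omega>\<bar> + \<bar>R (\<xi> \<omega>) \<eta> x\<bar>)"
      using int_h assms(9) by auto
    show "AE \<omega> in M. norm (f x (\<xi> \<omega>)) \<le> norm (\<bar>h x \<omega>\<bar> + \<bar>R (\<xi> \<omega>) \<eta> x\<bar>)"
      using sandwich[of x] by eventually_elim auto
  qed measurable
  have wc_F: "weakly_convex \<rho> F"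
    unfolding F_def using int_f assms(7) by (intro weakly_convex_expectation AE_I2)
  have wc_F_s: "weakly_convex \<rho>' F_s"
    unfolding F_s_eq'[abs_def]
  proof (rule weakly_convex_expectation[OF int_h])
    show "AE \<omega> in M. weakly_convex \<rho>' (\<lambda>x. h x \<omega>)"
      using approx by eventually_elim (simp add: smooth_approx_def)
  qed
  have \<rho>': "\<rho>' > 0"
  proof -
    \<comment> \<open>The statement does not mention \<omega>; on a probability space, holding
      almost surely then means holding outright.\<close>
    have "AE \<omega> in M. \<rho>' > 0"
      using approx by eventually_elim (simp add: smooth_approx_def)
    then show ?thesis
      by simp
  qed
  have F_le: "F_s x \<le> F x" "F x \<le> F_s x + R_E x" for x
  proof -
    show "F_s x \<le> F x"
      unfolding F_s_eq' F_def
      by (rule integral_mono_AE[OF int_h int_f]) (use sandwich[of x] in eventually_elim, auto)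
    have "F x \<le> expectation (\<lambda>\<omega>. h x \<omega> + R (\<xi> \<omega>) \<eta> x)"
      unfolding F_def
      by (rule integral_mono_AE[OF int_f])
        (use int_h assms(9) sandwich[of x] in \<open>auto elim: eventually_mono\<close>)
    then show "F x \<le> F_s x + R_E x"
      using int_h assms(9) by (simp add: F_s_eq' R_E_def)
  qed
  have "R_E x \<ge> 0" for x
    unfolding R_E_def by (rule integral_nonneg_AE)
      (use approx in eventually_elim, simp add: smooth_approx_def)
  moreover have "L_E x y \<ge> 0" for x y
    unfolding L_E_def by (rule integral_nonneg_AE)
      (use approx in eventually_elim, simp add: smooth_approx_def)
  moreover have "L_E x y = L_E y x" for x y
  proof -
    have "AE \<omega> in M. L (\<xi> \<omega>) \<eta> x y = L (\<xi> \<omega>) \<eta> y x"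
      using approx by eventually_elim (auto simp: smooth_approx_def)
    then show ?thesis
      unfolding L_E_def using assms(10)
      by (intro integral_cong_AE borel_measurable_integrable) auto
  qed
  ultimately have "smooth_approx \<rho>' R_E L_E F_s F"
    unfolding smooth_approx_def
    using assms(3) wc_F \<rho>' cont_diff wc_F_s F_le grad_lip by blast
  moreover have "has_bochner_integral (completion M)
      (\<lambda>\<omega>. grad (\<lambda>y. f_s \<eta> y (\<xi> \<omega>)) x) (grad F_s x)" for x
    using has_bochner_integral_integrable[OF G[of x]]
    unfolding grad_F by (simp add: G_def[abs_def] h_def M'_def)
  ultimately show ?thesis
    using gderiv_differentiable[OF GDERIV_F] by blast
qed

end
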